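(* Let $0<q<1$, $n\ge2$ and $\alpha<0$. For $N\ge0$ let $\eta_{n,1}$ be the smallest zero of the Stieltjes–Wigert-Sobolev-type polynomial $S_n^{(\alpha)}(N;x;q)$. Put $$N_0=\left(\frac{(\mathscr D_qS_n)(\alpha;q)}{S_n(0;q)}\mathscr K_{q,n}^{(0,1)}(0,\alpha)-\mathscr K_{q,n}^{(1,1)}(\alpha,\alpha)\right)^{-1}.$$ Then $N_0>0$, and $\eta_{n,1}>0$ for $N<N_0$, $\eta_{n,1}=0$ for $N=N_0$, and $\eta_{n,1}<0$ for $N>N_0$.
   Context: $(b;q)_k=\prod_{j=0}^{k-1}(1-bq^j)$, $(b_1,b_2;q)_\infty=\prod_{j\ge0}(1-b_1q^j)(1-b_2q^j)$. $(\mathscr D_qf)(x)=\frac{f(qx)-f(x)}{(q-1)x}$ for $x\ne0$, $(\mathscr D_qf)(0)=f'(0)$. $S_n(x;q)=(-1)^nq^{-n^2}\sum_{k=0}^n\frac{(q^{-n};q)_k}{(q;q)_k}q^{\binom k2}(q^{n+1}x)^k$ are the monic Stieltjes–Wigert polynomials, the monic orthogonal polynomials for $\langle{\bf u},f\rangle=\int_0^\infty f(x)\frac{dx}{(-x,-qx^{-1};q)_\infty}$; write $\|S_n\|^2=\langle{\bf u},S_n^2\rangle$. $S_n^{(\alpha)}(N;x;q)$ is the monic polynomial of degree $n$ orthogonal to all polynomials of degree $<n$ with respect to $\langle f,g\rangle_S=\langle{\bf u},fg\rangle+N(\mathscr D_qf)(\alpha)(\mathscr D_qg)(\alpha)$;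 its zeros are real. Kernels: $\mathscr K_{q,n}^{(i,j)}(x,y)=\sum_{k=0}^{n-1}\frac{(\mathscr D_q^iS_k)(x;q)(\mathscr D_q^jS_k)(y;q)}{\|S_k\|^2}$. *)

theory Defs
  imports "HOL-Analysis.Analysis" "HOL-Computational_Algebra.Polynomial"
begin

definition qpoch :: "real \<Rightarrow> real \<Rightarrow> nat \<Rightarrow> real" where
  "qpoch b q k = (\<Prod>j<k. 1 - b * q ^ j)"

definition qpoch_inf2 :: "real \<Rightarrow> real \<Rightarrow> real \<Rightarrow> real" where
  "qpoch_inf2 b1 b2 q = (\<Prod>j. (1 - b1 * q ^ j) * (1 - b2 * q ^ j))"

definition qderiv :: "real \<Rightarrow> (real \<Rightarrow> real) \<Rightarrow> real \<Rightarrow> real" where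
  "qderiv q f x = (if x = 0 then deriv f 0 else (f (q * x) - f x) / ((q - 1) * x))"

definition stieltjes_wigert :: "real \<Rightarrow> nat \<Rightarrow> real \<Rightarrow> real" where
  "stieltjes_wigert q n x =
     (-1) ^ n * q powi (- (int n)\<^sup>2) *
     (\<Sum>k\<le>n. qpoch (q powi (- int n)) q k / qpoch q q k * q ^ (k choose 2) * (q ^ (n + 1) * x) ^ k)"

definition sw_functional :: "real \<Rightarrow> (real \<Rightarrow> real) \<Rightarrow> real" where
  "sw_functional q f = (LINT x:{0<..}|lborel. f x / qpoch_inf2 (- x) (- (q / x)) q)"

definition sw_norm_sq :: "real \<Rightarrow> nat \<Rightarrow> real" where
  "sw_norm_sq q n = sw_functional q (\<lambda>x. (stieltjes_wigert q n x)\<^sup>2)"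

definition sw_kernel :: "real \<Rightarrow> nat \<Rightarrow> nat \<Rightarrow> nat \<Rightarrow> real \<Rightarrow> real \<Rightarrow> real" where
  "sw_kernel q n i j x y =
     (\<Sum>k<n. (qderiv q ^^ i) (stieltjes_wigert q k) x * (qderiv q ^^ j) (stieltjes_wigert q k) y
             / sw_norm_sq q k)"

definition sobolev_ip ::
    "real \<Rightarrow> real \<Rightarrow> real \<Rightarrow> (real \<Rightarrow> real) \<Rightarrow> (real \<Rightarrow> real) \<Rightarrow> real" where
  "sobolev_ip q \<alpha> N f g =
     sw_functional q (\<lambda>x. f x * g x) + N * qderiv q f \<alpha> * qderiv q g \<alpha>"

definition is_sw_sobolev :: "real \<Rightarrow> real \<Rightarrow> real \<Rightarrow> nat \<Rightarrow> real poly \<Rightarrow> bool" where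
  "is_sw_sobolev q \<alpha> N n p \<longleftrightarrow>
     degree p = n \<and> lead_coeff p = 1 \<and>
     (\<forall>g :: real poly. degree g < n \<longrightarrow> sobolev_ip q \<alpha> N (poly p) (poly g) = 0)"

definition sw_sobolev :: "real \<Rightarrow> real \<Rightarrow> real \<Rightarrow> nat \<Rightarrow> real poly" where
  "sw_sobolev q \<alpha> N n = (THE p. is_sw_sobolev q \<alpha> N n p)"

text \<open>All zeros of these polynomials are real, so the smallest zero is the least real root.\<close>

definition sw_sobolev_min_zero :: "real \<Rightarrow> real \<Rightarrow> real \<Rightarrow> nat \<Rightarrow> real" where
  "sw_sobolev_min_zero q \<alpha> N n = Min {x. poly (sw_sobolev q \<alpha> N n) x = 0}"

end

theory Submission
  imports Defs "HOL-Probability.Sinc_Integral"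
begin

text \<open>The critical mass \<open>N0\<close> is the mass at which 0 becomes a zero of the Sobolev-type polynomial. Everything
rests on a monotonicity of the Stieltjes--Wigert polynomials. Scale $S_n$ so that its value at 0 is 1, and
call the result $s_n$. In powers of \<open>- x\<close> its coefficients are
$$\<Prod>_{j<k} (q^j - q^n) \cdot \frac{q^{k(k+1)/2}}{(q;q)_k},$$
which are nonnegative and increase with \<open>n\<close>. Hence on the negative axis $s_m(x) < s_n(x)$ for
\<open>m < n\<close> (\<open>poly_sw_poly_strict_mono\<close>), and the numbers $e_n = -(D_q s_n)(\<alpha>)$ also increase strictly
(\<open>slope_sw_poly_strict_mono\<close>).

Let $h_k$ be the squared norm of $s_k$. By the reproducing property of the kernel, the Sobolev-type
polynomial is a multiple of
$$Q(x) = (1 + N \<Sum>_{k<n} \frac{e_k^2}{h_k}) s_n(x) - N e_n \<Sum>_{k<n} \frac{e_k}{h_k} s_k(x).$$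
At 0 this is $1 - N / N_0$ with $1 / N_0 = \<Sum>_{k<n} e_k (e_n - e_k) / h_k$, a sum of nonnegative terms
whose term for \<open>k = 1\<close> is positive; so $N_0 > 0$ (\<open>critical_mass_inverse_pos\<close>). For negative \<open>x\<close>, replacing
each $s_k(x)$ by the larger $s_n(x)$ gives $Q(x) \<ge> (1 - N / N_0)\, s_n(x)$, strictly if \<open>N > 0\<close>. Thus \<open>Q\<close>
has no negative zero when $N \<le> N_0$ (\<open>poly_sobolev_poly_pos\<close>). It always has a positive zero, since it is
orthogonal to the constant 1 for the original weight (\<open>sobolev_poly_has_positive_zero\<close>). When
$N > N_0$ it changes sign on the negative axis (\<open>sobolev_poly_has_negative_zero\<close>). The position of the
smallest zero follows in all three cases.

The orthogonality of the $s_n$ comes from the quasi-periodicity of the weight, which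
makes the moments explicit (\<open>sw_weight_shift\<close>, \<open>sw_moment_monom_add\<close>) and turns the orthogonality relations
into instances of the terminating q-binomial theorem (\<open>qpoch_binomial\<close>).\<close>

section \<open>The Stieltjes--Wigert weight and its moments\<close>

text \<open>The product is $(-y;q)_\<infinity>$; with this sign all its factors are at least 1 for \<open>y \<ge> 0\<close>.\<close>

definition qprod :: "real \<Rightarrow> real \<Rightarrow> real" where
  "qprod q y = (\<Prod>j. 1 + y * q ^ j)"

text \<open>The cut-off to the positive half-line is built into the weight, so that the functional becomes an
integral over the whole line and the substitution \<open>x \<mapsto> q x\<close> can be made there.\<close>

definition sw_weight :: "real \<Rightarrow> real \<Rightarrow> real" where
  "sw_weight q x = indicator {0<..} x / (qprod q x * qprod q (q / x))"

definition sw_moment :: "real \<Rightarrow> real poly \<Rightarrow> real" where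
  "sw_moment q p = sw_functional q (poly p)"

context
  fixes q :: real
  assumes q0: "0 < q" and q1: "q < 1"
begin

lemma qprod_convergent:
  assumes "0 \<le> y"
  shows "convergent_prod (\<lambda>j. 1 + y * q ^ j)"
proof (rule summable_imp_convergent_prod_real)
  show "summable (\<lambda>j. \<bar>y * q ^ j\<bar>)"
    using q0 q1 assms by (simp add: abs_mult summable_mult)
  show "y * q ^ j \<noteq> - 1" for j
    using q0 assms by (smt (verit) zero_le_mult_iff zero_le_power)
qed

lemma partial_prod_le_qprod:
  assumes "0 \<le> y"
  shows "(\<Prod>j<k. 1 + y * q ^ j) \<le> qprod q y"
  unfolding qprod_def
  by (rule prod_le_prodinf[OF convergent_prod_has_prod[OF qprod_convergent[OF assms]]])
    (use q0 assms in auto)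

lemma qprod_ge_1: "0 \<le> y \<Longrightarrow> 1 \<le> qprod q y"
  using partial_prod_le_qprod[of y 0] by simp

lemma qprod_pos: "0 \<le> y \<Longrightarrow> 0 < qprod q y"
  using qprod_ge_1[of y] by simp

lemma qprod_shift:
  assumes "0 \<le> y"
  shows "qprod q y = (1 + y) * qprod q (q * y)"
  using prodinf_split_head[OF qprod_convergent[OF assms]] assms
  by (simp add: qprod_def field_simps)

lemma qpoch_inf2_eq_qprod:
  assumes "0 < x"
  shows "qpoch_inf2 (- x) (- (q / x)) q = qprod q x * qprod q (q / x)"
  unfolding qprod_def qpoch_inf2_def
  using prodinf_mult[OF qprod_convergent[of x] qprod_convergent[of "q / x"]] assms q0 by simp

lemma sw_functional_eq: "sw_functional q f = (LINT x|lborel. f x * sw_weight q x)"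
  unfolding sw_functional_def set_lebesgue_integral_def sw_weight_def
  by (rule Bochner_Integration.integral_cong) (auto simp: indicator_def qpoch_inf2_eq_qprod)

lemma sw_weight_pos: "0 < x \<Longrightarrow> 0 < sw_weight q x"
  using qprod_pos[of x] qprod_pos[of "q / x"] q0 by (simp add: sw_weight_def)

lemma sw_weight_nonneg: "0 \<le> sw_weight q x"
  using sw_weight_pos[of x] by (cases "0 < x") (auto simp: sw_weight_def)

text \<open>This q-analogue of a Pearson equation determines all moments up to the total mass. It is the
quasi-periodicity of the theta function $(-x,-q/x;q)_\<infinity>$: replacing \<open>x\<close> by \<open>q x\<close> removes the
factor \<open>1 + x\<close> from the first product and adds the factor \<open>1 + 1 / x\<close> to the second.\<close>

lemma sw_weight_shift: "sw_weight q (q * x) = x * sw_weight q x"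
proof (cases "0 < x")
  case True
  have e: "q / (q * x) = 1 / x" using q0 by simp
  have shifts: "qprod q x = (1 + x) * qprod q (q * x)"
    "qprod q (1 / x) = (1 + x) / x * qprod q (q / x)"
    using True qprod_shift[of x] qprod_shift[of "1 / x"] by (simp_all add: field_simps)
  show ?thesis
    unfolding sw_weight_def e shifts using True q0 by simp
next
  case False
  then show ?thesis using q0 by (simp add: sw_weight_def zero_less_mult_iff)
qed

lemma sw_weight_measurable [measurable]: "sw_weight q \<in> borel_measurable lborel"
proof (rule borel_measurable_LIMSEQ_real)
  fix x :: real
  show "(\<lambda>n. indicator {0<..} x / ((\<Prod>j\<le>n. 1 + x * q ^ j) * (\<Prod>j\<le>n. 1 + q / x * q ^ j)))
          \<longlonglongrightarrow> sw_weight q x"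
  proof (cases "0 < x")
    case True
    then show ?thesis
      using qprod_pos[of x] qprod_pos[of "q / x"] q0 unfolding sw_weight_def qprod_def
      by (intro tendsto_intros convergent_prod_LIMSEQ qprod_convergent) auto
  qed (auto simp: sw_weight_def)
qed measurable

text \<open>The first \<open>k\<close> factors of the product at \<open>x\<close> already exceed a positive multiple of \<open>x ^ k\<close>, hence the
weight decays faster than every power.\<close>

lemma power_times_weight_le:
  assumes "0 < x"
  shows "x ^ k * sw_weight q x \<le> 1 / (\<Prod>j<k. q ^ j)"
proof -
  have "(\<Prod>j<k. q ^ j) * x ^ k = (\<Prod>j<k. x * q ^ j)"
    by (simp add: prod.distrib)
  also have "\<dots> \<le> (\<Prod>j<k. 1 + x * q ^ j)"
    by (rule prod_mono) (use assms q0 in auto)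
  also have "\<dots> \<le> qprod q x"
    using partial_prod_le_qprod assms by simp
  also have "\<dots> \<le> qprod q x * qprod q (q / x)"
    using qprod_pos[of x] qprod_ge_1[of "q / x"] assms q0 by simp
  finally show ?thesis
    using assms q0 qprod_pos[of x] qprod_pos[of "q / x"]
    by (simp add: sw_weight_def field_simps prod_pos)
qed

lemma integrable_power_times_weight: "integrable lborel (\<lambda>x. x ^ k * sw_weight q x)"
proof (rule Bochner_Integration.integrable_bound)
  \<comment> \<open>\<open>C\<close> bounds \<open>x ^ k + x ^ (k + 2)\<close> times the weight, which makes \<open>C / (1 + x\<^sup>2)\<close> a majorant.\<close>
  define C where "C = 1 / (\<Prod>j<k. q ^ j) + 1 / (\<Prod>j<k + 2. q ^ j)"
  show "integrable lborel (\<lambda>x. C * inverse (1 + x\<^sup>2))"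
    using integrable_inverse_1_plus_square by (simp add: set_integrable_def einterval_def)
  show "AE x in lborel. norm (x ^ k * sw_weight q x) \<le> norm (C * inverse (1 + x\<^sup>2))"
  proof (rule AE_I2)
    fix x :: real
    have C: "0 \<le> C" unfolding C_def using q0 by (simp add: prod_nonneg)
    show "norm (x ^ k * sw_weight q x) \<le> norm (C * inverse (1 + x\<^sup>2))"
    proof (cases "0 < x")
      case True
      have "x ^ k * sw_weight q x * (1 + x\<^sup>2) = x ^ k * sw_weight q x + x ^ (k + 2) * sw_weight q x"
        by (simp add: algebra_simps power_add power2_eq_square)
      also have "\<dots> \<le> C"
        unfolding C_def by (intro add_mono power_times_weight_le True)
      finally have "x ^ k * sw_weight q x \<le> C / (1 + x\<^sup>2)"
        by (simp add: pos_le_divide_eq add_pos_nonneg)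
      then show ?thesis
        using True C sw_weight_nonneg[of x] by (simp add: divide_inverse)
    next
      case False
      then show ?thesis by (simp add: sw_weight_def)
    qed
  qed
qed measurable

lemma integrable_poly_times_weight: "integrable lborel (\<lambda>x. poly p x * sw_weight q x)"
  unfolding poly_altdef sum_distrib_right mult.assoc
  by (intro Bochner_Integration.integrable_sum integrable_mult_right integrable_power_times_weight)

lemma sw_moment_eq: "sw_moment q p = (LINT x|lborel. poly p x * sw_weight q x)"
  by (simp add: sw_moment_def sw_functional_eq)

lemma sw_moment_add: "sw_moment q (a + b) = sw_moment q a + sw_moment q b"
  by (simp add: sw_moment_eq distrib_right integrable_poly_times_weight)

lemma sw_moment_smult: "sw_moment q (smult c a) = c * sw_moment q a"
  by (simp add: sw_moment_eq mult.assoc)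

lemma sw_moment_sum: "sw_moment q (\<Sum>i\<in>A. f i) = (\<Sum>i\<in>A. sw_moment q (f i))"
proof (induction A rule: infinite_finite_induct)
  case (insert i A)
  then show ?case by (simp add: sw_moment_add)
qed (simp_all add: sw_moment_eq)

text \<open>The weight is positive on \<open>(0, \<infinity>)\<close>, so a vanishing integral would force the polynomial to vanish at
almost every point of an interval, whereas it has only finitely many zeros.\<close>

lemma sw_moment_pos:
  assumes "p \<noteq> 0" and nonneg: "\<And>x. 0 < x \<Longrightarrow> 0 \<le> poly p x"
  shows "0 < sw_moment q p"
proof (rule ccontr)
  have *: "0 \<le> poly p x * sw_weight q x" for x
    using nonneg[of x] sw_weight_nonneg[of x] by (cases "0 < x") (auto simp: sw_weight_def)
  assume "\<not> 0 < sw_moment q p"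
  moreover have "0 \<le> sw_moment q p"
    unfolding sw_moment_eq using * by simp
  ultimately have "sw_moment q p = 0" by simp
  then have "AE x in lborel. poly p x * sw_weight q x = 0"
    unfolding sw_moment_eq
    by (subst (asm) integral_nonneg_eq_0_iff_AE[OF integrable_poly_times_weight]) (use * in auto)
  moreover have "AE x in lborel. x \<notin> {x. poly p x = 0}"
    by (intro AE_not_in finite_imp_null_set_lborel poly_roots_finite assms)
  ultimately have "AE x in lborel. x \<notin> {0<..<1::real}"
  proof (eventually_elim)
    case (elim x)
    then show ?case using sw_weight_pos[of x] by auto
  qed
  then have "emeasure lborel {0<..<1::real} = 0"
    by (subst (asm) AE_iff_measurable[of "{0<..<1}"]) auto
  then show False by simp
qed

lemma sw_moment_square_pos: "p \<noteq> 0 \<Longrightarrow> 0 < sw_moment q (p * p)"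
  by (rule sw_moment_pos) auto

text \<open>Substituting \<open>q x\<close> for \<open>x\<close> in the integral turns the functional equation of the weight into a
recurrence for its moments.\<close>

lemma sw_moment_monom_Suc: "sw_moment q (monom 1 m) = q ^ Suc m * sw_moment q (monom 1 (Suc m))"
proof -
  have "sw_moment q (monom 1 m) = (LINT x|lborel. x ^ m * sw_weight q x)"
    by (simp add: sw_moment_eq poly_monom)
  also have "\<dots> = q * (LINT x|lborel. (q * x) ^ m * sw_weight q (q * x))"
    using lborel_integral_real_affine[of q "\<lambda>x. x ^ m * sw_weight q x" 0] q0 by simp
  also have "\<dots> = q * (LINT x|lborel. q ^ m * (x ^ Suc m * sw_weight q x))"
    unfolding sw_weight_shift power_mult_distrib by (simp add: mult_ac)
  also have "\<dots> = q ^ Suc m * sw_moment q (monom 1 (Suc m))"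
    by (simp add: sw_moment_eq poly_monom)
  finally show ?thesis .
qed

lemma sw_moment_monom_add:
  "sw_moment q (monom 1 m) = q ^ (Suc k choose 2) * q ^ (m * k) * sw_moment q (monom 1 (m + k))"
proof (induction k)
  case (Suc k)
  have e: "Suc (Suc k) choose 2 = (Suc k choose 2) + Suc k"
    by (simp add: numeral_2_eq_2)
  show ?case
    unfolding e using Suc sw_moment_monom_Suc[of "m + k"] 
    by (simp add: power_add mult_ac numeral_2_eq_2)
qed (simp add: numeral_2_eq_2)

end

section \<open>Normalised Stieltjes--Wigert polynomials\<close>

text \<open>These are the coefficients, with respect to \<open>- x\<close>, of the Stieltjes--Wigert polynomial of degree \<open>n\<close>
scaled to take the value 1 at 0. Writing $(q^{-n};q)_k$ as a multiple of $\<Prod>_{j<k} (q^j - q^n)$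
shows two things at once: they are nonnegative, and they increase with \<open>n\<close>.\<close>

definition sw_coeff :: "real \<Rightarrow> nat \<Rightarrow> nat \<Rightarrow> real" where
  "sw_coeff q n k = (\<Prod>j<k. q ^ j - q ^ n) * q ^ (Suc k choose 2) / qpoch q q k"

definition sw_poly :: "real \<Rightarrow> nat \<Rightarrow> real poly" where
  "sw_poly q n = (\<Sum>k\<le>n. monom ((-1) ^ k * sw_coeff q n k) k)"

context
  fixes q :: real
  assumes q0: "0 < q" and q1: "q < 1"
begin

lemma qpoch_q_pos: "0 < qpoch q q k"
  unfolding qpoch_def
proof (rule prod_pos)
  fix j assume "j \<in> {..<k}"
  have "q ^ Suc j < 1" using q0 q1 power_Suc_less_one by blast
  then show "0 < 1 - q * q ^ j" by simp
qed

text \<open>The terminating q-binomial theorem of Rothe, with $(q^{-n};q)_k q^{nk}$ cleared of negative powers.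
The recurrence \<open>rec\<close> for the coefficients corresponds to
$(z;q)_{n+1} = (1 - z)\,(qz;q)_n$.\<close>

lemma qpoch_binomial:
  "(\<Sum>k\<le>n. (\<Prod>j<k. q ^ n - q ^ j) / qpoch q q k * z ^ k) = qpoch z q n"
proof (induction n arbitrary: z)
  case (Suc n)
  define A where "A n k = (\<Prod>j<k. q ^ n - q ^ j) / qpoch q q k" for n k :: nat
  have rec: "A (Suc n) (Suc k) = q ^ Suc k * A n (Suc k) - q ^ k * A n k" for k
  proof -
    have "(\<Prod>j<Suc k. q ^ Suc n - q ^ j) = (q ^ Suc n - 1) * (\<Prod>j<k. q * (q ^ n - q ^ j))"
      by (subst prod.lessThan_Suc_shift) (simp add: algebra_simps)
    also have "\<dots> = (q ^ Suc n - 1) * q ^ k * (\<Prod>j<k. q ^ n - q ^ j)"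
      by (simp add: prod.distrib)
    finally have num: "(\<Prod>j<Suc k. q ^ Suc n - q ^ j) = \<dots>" .
    have den: "qpoch q q (Suc k) = qpoch q q k * (1 - q ^ Suc k)"
      by (simp add: qpoch_def)
    then have nz: "qpoch q q k \<noteq> 0" "1 - q ^ Suc k \<noteq> 0"
      using qpoch_q_pos[of k] qpoch_q_pos[of "Suc k"] by auto
    show ?thesis
      unfolding A_def num den using nz
      by (simp add: divide_simps del: power_Suc) (simp add: algebra_simps)
  qed
  have vanish: "A n (Suc n) = 0"
    by (simp add: A_def)
  have "(\<Sum>k\<le>Suc n. A (Suc n) k * z ^ k)
      = A (Suc n) 0 + (\<Sum>k\<le>n. A (Suc n) (Suc k) * z ^ Suc k)"
    by (subst sum.atMost_Suc_shift) simp
  also have "\<dots> = (A n 0 + (\<Sum>k\<le>n. A n (Suc k) * (q * z) ^ Suc k)) - z * (\<Sum>k\<le>n. A n k * (q * z) ^ k)"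
    unfolding rec by (simp add: A_def sum_distrib_left algebra_simps power_mult_distrib sum_subtractf)
  also have "A n 0 + (\<Sum>k\<le>n. A n (Suc k) * (q * z) ^ Suc k) = (\<Sum>k\<le>Suc n. A n k * (q * z) ^ k)"
    by (subst sum.atMost_Suc_shift) simp
  also have "\<dots> = (\<Sum>k\<le>n. A n k * (q * z) ^ k)"
    using vanish by simp
  also have "(\<Sum>k\<le>n. A n k * (q * z) ^ k) = qpoch (q * z) q n"
    unfolding A_def by (rule Suc)
  also have "qpoch (q * z) q n - z * qpoch (q * z) q n = (1 - z) * qpoch (q * z) q n"
    by (simp add: algebra_simps)
  also have "\<dots> = qpoch z q (Suc n)"
    unfolding qpoch_def prod.lessThan_Suc_shift by (simp add: mult_ac)
  finally show ?case
    unfolding A_def .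
qed (simp add: qpoch_def)

lemma sw_coeff_pos: "k \<le> n \<Longrightarrow> 0 < sw_coeff q n k"
  unfolding sw_coeff_def using q0 q1 qpoch_q_pos
  by (intro divide_pos_pos mult_pos_pos prod_pos) (auto intro!: power_strict_decreasing)

lemma sw_coeff_eq_0: "n < k \<Longrightarrow> sw_coeff q n k = 0"
  by (auto simp: sw_coeff_def)

lemma sw_coeff_mono:
  assumes "m \<le> n"
  shows "sw_coeff q m k \<le> sw_coeff q n k"
proof (cases "k \<le> m")
  case True
  then show ?thesis
    unfolding sw_coeff_def using q0 q1 assms qpoch_q_pos[of k]
    by (intro divide_right_mono mult_right_mono prod_mono)
      (auto intro!: power_decreasing simp: less_imp_le)
next
  case False
  then show ?thesis
    using sw_coeff_pos[of k n] sw_coeff_eq_0[of n k] sw_coeff_eq_0[of m k]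
    by (cases "k \<le> n") auto
qed

text \<open>One strictly increasing coefficient suffices to make all the comparisons below strict.\<close>

lemma sw_coeff_1_strict_mono:
  assumes "m < n"
  shows "sw_coeff q m 1 < sw_coeff q n 1"
proof -
  have "q ^ n < q ^ m" by (rule power_strict_decreasing[OF assms q0 q1])
  then show ?thesis
    using q0 qpoch_q_pos[of 1]
    by (simp add: sw_coeff_def divide_strict_right_mono)
qed

lemma coeff_sw_poly: "coeff (sw_poly q n) k = (-1) ^ k * sw_coeff q n k"
  by (cases "k \<le> n") (auto simp: sw_poly_def coeff_sum sw_coeff_eq_0 if_distrib cong: if_cong)

lemma degree_sw_poly [simp]: "degree (sw_poly q n) = n"
proof (rule antisym)
  show "degree (sw_poly q n) \<le> n"
    by (rule degree_le) (simp add: coeff_sw_poly sw_coeff_eq_0)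
  show "n \<le> degree (sw_poly q n)"
    by (rule le_degree) (use sw_coeff_pos[of n n] in \<open>simp add: coeff_sw_poly\<close>)
qed

lemma sw_poly_nonzero [simp]: "sw_poly q n \<noteq> 0"
  using sw_coeff_pos[of n n] coeff_sw_poly[of n n] by auto

lemma poly_sw_poly_uminus:
  assumes "n \<le> M"
  shows "poly (sw_poly q n) (- t) = (\<Sum>k\<le>M. sw_coeff q n k * t ^ k)"
proof -
  have "poly (sw_poly q n) (- t) = (\<Sum>k\<le>n. sw_coeff q n k * t ^ k)"
    unfolding sw_poly_def poly_sum poly_monom
  proof (rule sum.cong)
    show "(-1) ^ k * sw_coeff q n k * (- t) ^ k = sw_coeff q n k * t ^ k" for k
      by (cases "even k") auto
  qed simp
  also have "\<dots> = (\<Sum>k\<le>M. sw_coeff q n k * t ^ k)"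
    by (rule sum.mono_neutral_left) (use assms sw_coeff_eq_0 in auto)
  finally show ?thesis .
qed

lemma poly_sw_poly_0 [simp]: "poly (sw_poly q n) 0 = 1"
  by (simp add: poly_0_coeff_0 coeff_sw_poly sw_coeff_def qpoch_def numeral_2_eq_2)

text \<open>On the negative axis the polynomials are combinations of powers of \<open>- x > 0\<close> whose nonnegative
coefficients increase with the degree.\<close>

lemma poly_sw_poly_strict_mono:
  assumes "x < 0" and "m < n"
  shows "poly (sw_poly q m) x < poly (sw_poly q n) x"
proof -
  have "(\<Sum>k\<le>n. sw_coeff q m k * (- x) ^ k) < (\<Sum>k\<le>n. sw_coeff q n k * (- x) ^ k)"
  proof (rule sum_strict_mono_ex1)
    show "\<exists>k\<in>{..n}. sw_coeff q m k * (- x) ^ k < sw_coeff q n k * (- x) ^ k"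
      using sw_coeff_1_strict_mono[OF assms(2)] assms by (intro bexI[of _ 1]) auto
  qed (use assms sw_coeff_mono in \<open>auto intro!: mult_right_mono\<close>)
  then show ?thesis
    using poly_sw_poly_uminus[of _ n "- x"] assms by simp
qed

lemma poly_sw_poly_ge_1: "x < 0 \<Longrightarrow> 1 \<le> poly (sw_poly q n) x"
  using poly_sw_poly_strict_mono[of x 0 n] poly_sw_poly_uminus[of 0 0 "- x"]
  by (cases "n = 0") (auto simp: sw_coeff_def qpoch_def numeral_2_eq_2)

lemma stieltjes_wigert_eq:
  "stieltjes_wigert q n x = (-1) ^ n * q powi (- (int n)\<^sup>2) * poly (sw_poly q n) x"
proof -
  have "qpoch (q powi (- int n)) q k / qpoch q q k * q ^ (k choose 2) * (q ^ (n + 1) * x) ^ k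
      = (-1) ^ k * sw_coeff q n k * x ^ k" for k
  proof -
    have "qpoch (q powi (- int n)) q k * (q ^ n) ^ k = (\<Prod>j<k. q ^ n * (1 - q powi (- int n) * q ^ j))"
      by (simp add: qpoch_def prod.distrib)
    also have "\<dots> = (\<Prod>j<k. (-1) * (q ^ j - q ^ n))"
      using q0 by (intro prod.cong) (auto simp: power_int_minus field_simps)
    also have "\<dots> = (-1) ^ k * (\<Prod>j<k. q ^ j - q ^ n)"
      by (simp only: prod.distrib prod_constant card_lessThan)
    finally have 1: "qpoch (q powi (- int n)) q k * (q ^ n) ^ k = \<dots>" .
    have "q ^ (Suc k choose 2) = q ^ (k choose 2) * q ^ k"
      by (simp add: numeral_2_eq_2 power_add)
    then show ?thesis
      using 1 by (simp add: sw_coeff_def power_mult_distrib power_add field_simps)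
  qed
  then show ?thesis
    unfolding stieltjes_wigert_def sw_poly_def poly_sum poly_monom by simp
qed

text \<open>Inserting the moments produces a q-binomial sum with parameter $q^{-m}$, and $(q^{-m};q)_n$ contains
the factor $1 - q^{-m} q^m = 0$ as soon as \<open>m < n\<close>.\<close>

lemma sw_moment_sw_poly_monom:
  assumes "m < n"
  shows "sw_moment q (sw_poly q n * monom 1 m) = 0"
proof -
  define z where "z = inverse (q ^ m)"
  have "sw_moment q (sw_poly q n * monom 1 m)
      = (\<Sum>k\<le>n. (-1) ^ k * sw_coeff q n k * sw_moment q (monom 1 (m + k)))"
  proof -
    have "sw_poly q n * monom 1 m
        = (\<Sum>k\<le>n. smult ((-1) ^ k * sw_coeff q n k) (monom 1 (m + k)))"
      unfolding sw_poly_def sum_distrib_right by (simp add: mult_monom smult_monom add.commute)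
    then show ?thesis
      by (simp add: sw_moment_sum[OF q0 q1] sw_moment_smult[OF q0 q1])
  qed
  also have "\<dots> = (\<Sum>k\<le>n. sw_moment q (monom 1 m) * ((\<Prod>j<k. q ^ n - q ^ j) / qpoch q q k * z ^ k))"
  proof (rule sum.cong)
    fix k
    have "(\<Prod>j<k. q ^ n - q ^ j) = (\<Prod>j<k. (-1) * (q ^ j - q ^ n))"
      by simp
    also have "\<dots> = (-1) ^ k * (\<Prod>j<k. q ^ j - q ^ n)"
      by (simp only: prod.distrib prod_constant card_lessThan)
    finally have sign: "(\<Prod>j<k. q ^ n - q ^ j) = \<dots>" .
    have "z ^ k * q ^ (m * k) = 1"
      unfolding power_mult power_mult_distrib[symmetric] using q0 by (simp add: z_def)
    then show "(-1) ^ k * sw_coeff q n k * sw_moment q (monom 1 (m + k))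
        = sw_moment q (monom 1 m) * ((\<Prod>j<k. q ^ n - q ^ j) / qpoch q q k * z ^ k)"
      unfolding sign sw_coeff_def sw_moment_monom_add[OF q0 q1, of m k] by (simp add: mult_ac)
  qed simp
  also have "\<dots> = sw_moment q (monom 1 m) * qpoch z q n"
    by (simp only: qpoch_binomial flip: sum_distrib_left)
  also have "qpoch z q n = 0"
    unfolding qpoch_def using assms q0 by (intro prod_zero bexI[of _ m]) (auto simp: z_def)
  finally show ?thesis by simp
qed

lemma sw_moment_sw_poly_orthogonal:
  assumes "degree g < n"
  shows "sw_moment q (sw_poly q n * g) = 0"
proof -
  have "sw_poly q n * g = (\<Sum>m\<le>degree g. smult (coeff g m) (sw_poly q n * monom 1 m))"
    by (subst poly_as_sum_of_monoms[of g, symmetric])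
      (simp add: sum_distrib_left smult_monom flip: mult_smult_right)
  then show ?thesis
    using assms
    by (simp add: sw_moment_sum[OF q0 q1] sw_moment_smult[OF q0 q1] sw_moment_sw_poly_monom)
qed

end

section \<open>The reproducing kernel for the q-slope\<close>

definition sw_sqnorm :: "real \<Rightarrow> nat \<Rightarrow> real" where
  "sw_sqnorm q k = sw_moment q (sw_poly q k * sw_poly q k)"

text \<open>The sign makes the slope of every normalised Stieltjes--Wigert polynomial at a negative point
nonnegative, since these polynomials decrease on the negative axis.\<close>

definition slope :: "real \<Rightarrow> real \<Rightarrow> real poly \<Rightarrow> real" where
  "slope q \<alpha> p = - qderiv q (poly p) \<alpha>"

text \<open>Up to sign this is the kernel \<open>K(x, \<alpha>)\<close> with one q-derivative in the second variable. It does not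
depend on how the orthogonal polynomials are scaled, so the normalised ones may be used.\<close>

definition slope_kernel :: "real \<Rightarrow> real \<Rightarrow> nat \<Rightarrow> real poly" where
  "slope_kernel q \<alpha> n =
     (\<Sum>k<n. smult (slope q \<alpha> (sw_poly q k) / sw_sqnorm q k) (sw_poly q k))"

text \<open>A polynomial \<open>s n - c K\<close> has Sobolev product \<open>(N D(s n - c K) - c) D g\<close> with every \<open>g\<close> of smaller
degree, where \<open>D\<close> is the slope. This vanishes when \<open>c (1 + N D K) = N D(s n)\<close>; multiplying by
\<open>1 + N D K\<close> removes the denominator and makes the polynomial affine in \<open>N\<close>.\<close>

definition sobolev_poly :: "real \<Rightarrow> real \<Rightarrow> nat \<Rightarrow> real \<Rightarrow> real poly" where
  "sobolev_poly q \<alpha> n N =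
     smult (1 + N * slope q \<alpha> (slope_kernel q \<alpha> n)) (sw_poly q n)
     - smult (N * slope q \<alpha> (sw_poly q n)) (slope_kernel q \<alpha> n)"

text \<open>The number is chosen so that the Sobolev polynomial takes the value \<open>1 - N * critical_mass_inverse\<close>
at 0.\<close>

definition critical_mass_inverse :: "real \<Rightarrow> real \<Rightarrow> nat \<Rightarrow> real" where
  "critical_mass_inverse q \<alpha> n =
     slope q \<alpha> (sw_poly q n) * poly (slope_kernel q \<alpha> n) 0 - slope q \<alpha> (slope_kernel q \<alpha> n)"

context
  fixes q \<alpha> :: real
  assumes q0: "0 < q" and q1: "q < 1" and \<alpha>0: "\<alpha> < 0"
begin

private abbreviation s :: "nat \<Rightarrow> real poly" where
  "s \<equiv> sw_poly q"

private abbreviation D :: "real poly \<Rightarrow> real" where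
  "D \<equiv> slope q \<alpha>"

private abbreviation K :: "nat \<Rightarrow> real poly" where
  "K \<equiv> slope_kernel q \<alpha>"

lemmas [simp] = degree_sw_poly[OF q0 q1] sw_poly_nonzero[OF q0 q1] poly_sw_poly_0[OF q0 q1]

lemmas moment_add = sw_moment_add[OF q0 q1] and moment_smult = sw_moment_smult[OF q0 q1]
  and moment_sum = sw_moment_sum[OF q0 q1]

lemma slope_eq: "D p = (poly p \<alpha> - poly p (q * \<alpha>)) / ((q - 1) * \<alpha>)"
  using \<alpha>0 by (simp add: slope_def qderiv_def minus_divide_left)

lemma slope_add: "D (a + b) = D a + D b"
  by (simp add: slope_eq add_divide_distrib diff_divide_distrib)

lemma slope_smult: "D (smult c a) = c * D a"
  by (simp add: slope_eq right_diff_distrib)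

lemma slope_diff: "D (a - b) = D a - D b"
  by (simp add: slope_eq add_divide_distrib diff_divide_distrib)

lemma slope_sum: "D (\<Sum>i\<in>A. f i) = (\<Sum>i\<in>A. D (f i))"
proof (induction A rule: infinite_finite_induct)
  case (insert i A)
  then show ?case by (simp add: slope_add)
qed (simp_all add: slope_eq)

lemma slope_const: "degree p = 0 \<Longrightarrow> D p = 0"
  by (auto elim!: degree_eq_zeroE simp: slope_eq)

text \<open>The slope is a combination of the coefficients with nonnegative weights
$t^k - (qt)^k$, where \<open>t = - \<alpha>\<close>, so it inherits their monotonicity in the degree.\<close>

lemma slope_sw_poly_strict_mono:
  assumes "m < n"
  shows "D (s m) < D (s n)"
proof -
  define t where "t = - \<alpha>"
  have t: "0 < t" using \<alpha>0 by (simp add: t_def)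
  have diff: "poly (s m) \<alpha> - poly (s m) (q * \<alpha>) = (\<Sum>k\<le>n. sw_coeff q m k * (t ^ k - (q * t) ^ k))"
    if "m \<le> n" for m
    using poly_sw_poly_uminus[OF q0 q1 that, of t] poly_sw_poly_uminus[OF q0 q1 that, of "q * t"]
    by (simp add: t_def sum_subtractf right_diff_distrib)
  have "(\<Sum>k\<le>n. sw_coeff q m k * (t ^ k - (q * t) ^ k)) < (\<Sum>k\<le>n. sw_coeff q n k * (t ^ k - (q * t) ^ k))"
  proof (rule sum_strict_mono_ex1)
    have "(q * t) ^ k \<le> t ^ k" for k
      using q0 q1 t by (intro power_mono) auto
    then show "\<forall>k\<in>{..n}. sw_coeff q m k * (t ^ k - (q * t) ^ k) \<le> sw_coeff q n k * (t ^ k - (q * t) ^ k)"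
      using sw_coeff_mono[OF q0 q1, of m n] assms by (auto intro!: mult_right_mono)
    show "\<exists>k\<in>{..n}. sw_coeff q m k * (t ^ k - (q * t) ^ k) < sw_coeff q n k * (t ^ k - (q * t) ^ k)"
      using sw_coeff_1_strict_mono[OF q0 q1 assms] assms q1 t
      by (intro bexI[of _ 1]) auto
  qed simp
  then show ?thesis
    unfolding slope_eq using diff[of m] diff[of n] assms q1 \<alpha>0
    by (intro divide_strict_right_mono) (auto intro: mult_neg_neg)
qed

lemma slope_sw_poly_0 [simp]: "D (s 0) = 0"
  by (rule slope_const) simp

lemma slope_sw_poly_nonneg: "0 \<le> D (s k)"
  using slope_sw_poly_strict_mono[of 0 k] by (cases "k = 0") auto

lemma sw_sqnorm_pos: "0 < sw_sqnorm q k"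
  unfolding sw_sqnorm_def by (rule sw_moment_square_pos[OF q0 q1]) simp

lemma sw_moment_sw_poly_sw_poly: "sw_moment q (s i * s j) = (if i = j then sw_sqnorm q i else 0)"
  using sw_moment_sw_poly_orthogonal[OF q0 q1, of "s i" j]
    sw_moment_sw_poly_orthogonal[OF q0 q1, of "s j" i]
  by (cases i j rule: linorder_cases) (auto simp: sw_sqnorm_def mult.commute)

text \<open>Subtracting the multiple of \<open>s n\<close> that cancels the leading term lowers the degree bound. The bound
is phrased through coefficients in the induction so that the zero polynomial needs no separate case.\<close>

lemma sw_poly_expansion:
  assumes "degree g < n"
  shows "\<exists>c. g = (\<Sum>k<n. smult (c k) (s k))"
proof -
  have "\<exists>c. g = (\<Sum>k<n. smult (c k) (s k))" if "\<forall>k\<ge>n. coeff g k = 0" for g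
    using that
  proof (induction n arbitrary: g)
    case 0
    then show ?case by (auto simp: poly_eq_iff)
  next
    case (Suc n)
    define a where "a = coeff g n / coeff (s n) n"
    have nz: "coeff (s n) n \<noteq> 0"
      using leading_coeff_neq_0[of "s n"] by simp
    have "\<forall>k\<ge>n. coeff (g - smult a (s n)) k = 0"
    proof (intro allI impI)
      fix k assume "n \<le> k"
      then show "coeff (g - smult a (s n)) k = 0"
        using Suc.prems nz by (cases "k = n") (auto simp: a_def coeff_eq_0)
    qed
    then obtain c where c: "g - smult a (s n) = (\<Sum>k<n. smult (c k) (s k))"
      using Suc.IH by blast
    then have "g = (\<Sum>k<Suc n. smult ((c(n := a)) k) (s k))"
      by (simp add: algebra_simps)
    then show ?case by blast
  qed
  moreover have "\<forall>k\<ge>n. coeff g k = 0"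
    using assms by (auto intro: coeff_eq_0)
  ultimately show ?thesis by blast
qed

lemma slope_kernel_reproducing:
  assumes "degree g < n"
  shows "sw_moment q (K n * g) = D g"
proof -
  obtain c where c: "g = (\<Sum>j<n. smult (c j) (s j))"
    using sw_poly_expansion[OF assms] by blast
  have "sw_moment q (K n * s j) = D (s j)" if "j < n" for j
  proof -
    have "sw_moment q (K n * s j) = (\<Sum>k<n. D (s k) / sw_sqnorm q k * sw_moment q (s k * s j))"
      unfolding slope_kernel_def by (simp add: sum_distrib_right moment_sum moment_smult)
    also have "\<dots> = (\<Sum>k<n. if k = j then D (s j) else 0)"
      using sw_sqnorm_pos[of j] by (intro sum.cong) (auto simp: sw_moment_sw_poly_sw_poly)
    finally show ?thesis using that by simp
  qed
  then show ?thesis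
    unfolding c by (simp add: sum_distrib_left moment_sum moment_smult slope_sum slope_smult)
qed

lemma slope_kernel_eq_sum:
  "poly (K n) x = (\<Sum>k<n. D (s k) / sw_sqnorm q k * poly (s k) x)"
  "D (K n) = (\<Sum>k<n. D (s k) / sw_sqnorm q k * D (s k))"
  by (simp_all add: slope_kernel_def poly_sum slope_sum slope_smult)

lemma slope_slope_kernel_nonneg: "0 \<le> D (K n)"
  unfolding slope_kernel_eq_sum using sw_sqnorm_pos
  by (intro sum_nonneg) (simp add: less_imp_le)

lemma degree_slope_kernel:
  assumes "0 < n"
  shows "degree (K n) < n"
  unfolding slope_kernel_def using assms
  by (intro degree_sum_less) (auto intro: le_less_trans[OF degree_smult_le])

section \<open>The Sobolev polynomial\<close>

text \<open>The two minus signs in the slopes cancel.\<close>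

lemma sobolev_ip_poly:
  "sobolev_ip q \<alpha> N (poly f) (poly g) = sw_moment q (f * g) + N * D f * D g"
proof -
  have "(\<lambda>x. poly f x * poly g x) = poly (f * g)" by auto
  then show ?thesis by (simp add: sobolev_ip_def slope_def sw_moment_def)
qed

lemma sobolev_poly_orthogonal:
  assumes "degree g < n"
  shows "sobolev_ip q \<alpha> N (poly (sobolev_poly q \<alpha> n N)) (poly g) = 0"
proof -
  have "sobolev_poly q \<alpha> n N * g = smult (1 + N * D (K n)) (s n * g) + smult (- (N * D (s n))) (K n * g)"
    by (simp add: sobolev_poly_def algebra_simps)
  then have "sw_moment q (sobolev_poly q \<alpha> n N * g) = - (N * D (s n)) * D g"
    by (simp only: moment_add moment_smult sw_moment_sw_poly_orthogonal[OF q0 q1 assms]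
        slope_kernel_reproducing[OF assms])
  moreover have "D (sobolev_poly q \<alpha> n N) = D (s n)"
    by (simp add: sobolev_poly_def slope_diff slope_smult algebra_simps)
  ultimately show ?thesis
    by (simp add: sobolev_ip_poly)
qed

lemma degree_sobolev_poly:
  assumes "0 < n" "0 \<le> N"
  shows "degree (sobolev_poly q \<alpha> n N) = n"
    and "0 < (-1) ^ n * lead_coeff (sobolev_poly q \<alpha> n N)"
proof -
  have c: "coeff (sobolev_poly q \<alpha> n N) n = (1 + N * D (K n)) * ((-1) ^ n * sw_coeff q n n)"
    using coeff_eq_0[OF degree_slope_kernel[OF assms(1)]]
    by (simp add: sobolev_poly_def coeff_sw_poly[OF q0 q1])
  have pos: "0 < (1 + N * D (K n)) * sw_coeff q n n"
    using sw_coeff_pos[OF q0 q1, of n n] assms slope_slope_kernel_nonneg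
    by (intro mult_pos_pos add_pos_nonneg) auto
  show deg: "degree (sobolev_poly q \<alpha> n N) = n"
  proof (rule antisym)
    show "degree (sobolev_poly q \<alpha> n N) \<le> n"
      unfolding sobolev_poly_def
      using degree_slope_kernel[OF assms(1)]
      by (intro degree_diff_le) (auto intro: order_trans[OF degree_smult_le])
    show "n \<le> degree (sobolev_poly q \<alpha> n N)"
      by (rule le_degree) (use c pos in auto)
  qed
  have "(-1) ^ n * coeff (sobolev_poly q \<alpha> n N) n = (1 + N * D (K n)) * sw_coeff q n n"
    unfolding c by (simp flip: power_mult_distrib add: algebra_simps)
  then show "0 < (-1) ^ n * lead_coeff (sobolev_poly q \<alpha> n N)"
    using pos deg by simp
qed

text \<open>The difference of two candidates has smaller degree, hence is orthogonal to itself; but for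
\<open>N \<ge> 0\<close> the Sobolev product is positive definite on polynomials.\<close>

lemma is_sw_sobolev_unique:
  assumes "0 \<le> N" "is_sw_sobolev q \<alpha> N n p" "is_sw_sobolev q \<alpha> N n p'"
  shows "p = p'"
proof (rule ccontr)
  assume ne: "p \<noteq> p'"
  have "degree (p - p') < n"
  proof (rule ccontr)
    assume "\<not> degree (p - p') < n"
    moreover have "degree (p - p') \<le> n"
      using assms by (intro degree_diff_le) (auto simp: is_sw_sobolev_def)
    ultimately have "degree (p - p') = n" by simp
    moreover have "coeff (p - p') n = 0"
      using assms by (auto simp: is_sw_sobolev_def)
    ultimately show False
      using ne leading_coeff_neq_0[of "p - p'"] by simp
  qed
  then have "sobolev_ip q \<alpha> N (poly p) (poly (p - p')) = 0"
    "sobolev_ip q \<alpha> N (poly p') (poly (p - p')) = 0"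
    using assms by (auto simp: is_sw_sobolev_def)
  then have "sw_moment q (p * (p - p')) + N * D p * D (p - p') = 0"
    "sw_moment q (p' * (p - p')) + N * D p' * D (p - p') = 0"
    unfolding sobolev_ip_poly .
  moreover have "sw_moment q (p * (p - p')) = sw_moment q ((p - p') * (p - p')) + sw_moment q (p' * (p - p'))"
    unfolding moment_add[symmetric] by (simp add: algebra_simps)
  ultimately have "sw_moment q ((p - p') * (p - p')) + N * (D (p - p') * D (p - p')) = 0"
    by (simp add: slope_diff algebra_simps)
  moreover have "0 \<le> N * (D (p - p') * D (p - p'))"
    using assms by simp
  ultimately show False
    using sw_moment_square_pos[OF q0 q1, of "p - p'"] ne by simp
qed

lemma sw_sobolev_min_zero_eq:
  assumes "0 < n" "0 \<le> N"
  shows "sw_sobolev_min_zero q \<alpha> N n = Min {x. poly (sobolev_poly q \<alpha> n N) x = 0}"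
proof -
  define Q where "Q = sobolev_poly q \<alpha> n N"
  define c where "c = inverse (lead_coeff Q)"
  have lc: "lead_coeff Q \<noteq> 0"
    using degree_sobolev_poly[OF assms] by (auto simp: Q_def)
  have "is_sw_sobolev q \<alpha> N n (smult c Q)"
    unfolding is_sw_sobolev_def
  proof (intro conjI allI impI)
    show "degree (smult c Q) = n" "lead_coeff (smult c Q) = 1"
      using lc degree_sobolev_poly[OF assms] by (auto simp: c_def Q_def)
    fix g :: "real poly" assume "degree g < n"
    then have "sw_moment q (Q * g) + N * D Q * D g = 0"
      using sobolev_poly_orthogonal[of g n N] by (simp add: Q_def sobolev_ip_poly)
    then have "c * (sw_moment q (Q * g) + N * D Q * D g) = 0" by simp
    then show "sobolev_ip q \<alpha> N (poly (smult c Q)) (poly g) = 0"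
      unfolding sobolev_ip_poly mult_smult_left moment_smult slope_smult by (simp add: algebra_simps)
  qed
  then have "sw_sobolev q \<alpha> N n = smult c Q"
    unfolding sw_sobolev_def using is_sw_sobolev_unique[OF assms(2)] by blast
  then show ?thesis
    using lc unfolding sw_sobolev_min_zero_def by (simp add: c_def Q_def)
qed

lemma stieltjes_wigert_scaled:
  obtains a where "a \<noteq> 0" "stieltjes_wigert q k = (\<lambda>x. a * poly (s k) x)"
proof
  show "(-1) ^ k * q powi (- (int k)\<^sup>2) \<noteq> 0"
    using q0 by (simp add: power_int_not_zero)
  show "stieltjes_wigert q k = (\<lambda>x. (-1) ^ k * q powi (- (int k)\<^sup>2) * poly (s k) x)"
    by (rule ext) (rule stieltjes_wigert_eq[OF q0 q1])
qed

lemma sw_norm_sq_eq: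
  assumes "stieltjes_wigert q k = (\<lambda>x. a * poly (s k) x)"
  shows "sw_norm_sq q k = a\<^sup>2 * sw_sqnorm q k"
proof -
  have "(\<lambda>x. (a * poly (s k) x)\<^sup>2) = poly (smult (a\<^sup>2) (s k * s k))"
    by (auto simp: power2_eq_square)
  then have "sw_norm_sq q k = sw_moment q (smult (a\<^sup>2) (s k * s k))"
    by (simp only: sw_norm_sq_def assms sw_moment_def)
  then show ?thesis by (simp only: moment_smult sw_sqnorm_def)
qed

lemma qderiv_scaled: "qderiv q (\<lambda>x. a * poly p x) \<alpha> = - a * D p"
  using \<alpha>0 by (simp add: slope_eq qderiv_def divide_simps) (simp add: algebra_simps)

text \<open>Both expressions are unchanged when the orthogonal polynomials are rescaled; on the left they are the
monic ones, and \<open>critical_mass_inverse\<close> uses the ones with value 1 at 0.\<close>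

lemma critical_mass_inverse_eq:
  "qderiv q (stieltjes_wigert q n) \<alpha> / stieltjes_wigert q n 0 * sw_kernel q n 0 1 0 \<alpha>
     - sw_kernel q n 1 1 \<alpha> \<alpha> = critical_mass_inverse q \<alpha> n"
proof -
  have "sw_kernel q n 0 1 0 \<alpha> = - poly (K n) 0"
    unfolding sw_kernel_def slope_kernel_eq_sum sum_negf[symmetric]
  proof (rule sum.cong)
    fix k
    obtain a where "a \<noteq> 0" "stieltjes_wigert q k = (\<lambda>x. a * poly (s k) x)"
      by (rule stieltjes_wigert_scaled)
    then show "(qderiv q ^^ 0) (stieltjes_wigert q k) 0 * (qderiv q ^^ 1) (stieltjes_wigert q k) \<alpha>
        / sw_norm_sq q k = - (D (s k) / sw_sqnorm q k * poly (s k) 0)"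
      by (simp add: sw_norm_sq_eq qderiv_scaled power2_eq_square)
  qed simp
  moreover have "sw_kernel q n 1 1 \<alpha> \<alpha> = D (K n)"
    unfolding sw_kernel_def slope_kernel_eq_sum
  proof (rule sum.cong)
    fix k
    obtain a where "a \<noteq> 0" "stieltjes_wigert q k = (\<lambda>x. a * poly (s k) x)"
      by (rule stieltjes_wigert_scaled)
    then show "(qderiv q ^^ 1) (stieltjes_wigert q k) \<alpha> * (qderiv q ^^ 1) (stieltjes_wigert q k) \<alpha>
        / sw_norm_sq q k = D (s k) / sw_sqnorm q k * D (s k)"
      by (simp add: sw_norm_sq_eq qderiv_scaled power2_eq_square)
  qed simp
  moreover have "qderiv q (stieltjes_wigert q n) \<alpha> / stieltjes_wigert q n 0 = - D (s n)"
  proof -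
    obtain a where "a \<noteq> 0" "stieltjes_wigert q n = (\<lambda>x. a * poly (s n) x)"
      by (rule stieltjes_wigert_scaled)
    then show ?thesis by (simp add: qderiv_scaled)
  qed
  ultimately show ?thesis by (simp add: critical_mass_inverse_def)
qed

section \<open>Signs on the negative axis and the smallest zero\<close>

text \<open>The difference is a sum of the nonnegative terms \<open>D (s k) (D (s n) - D (s k))\<close> over the squared norms,
and the one for \<open>k = 1\<close> is positive. That term is present because \<open>n \<ge> 2\<close>.\<close>

lemma critical_mass_inverse_pos:
  assumes "2 \<le> n"
  shows "0 < critical_mass_inverse q \<alpha> n"
proof -
  have "critical_mass_inverse q \<alpha> n = (\<Sum>k<n. D (s k) / sw_sqnorm q k * (D (s n) - D (s k)))"
    by (simp add: critical_mass_inverse_def slope_kernel_eq_sum sum_distrib_left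
        right_diff_distrib sum_subtractf mult_ac)
  also have "\<dots> > 0"
  proof (rule sum_pos2[where i = 1])
    show "0 < D (s 1) / sw_sqnorm q 1 * (D (s n) - D (s 1))"
      using slope_sw_poly_strict_mono[of 0 1] slope_sw_poly_strict_mono[of 1 n] sw_sqnorm_pos[of 1]
        assms by simp
    show "0 \<le> D (s k) / sw_sqnorm q k * (D (s n) - D (s k))" if "k \<in> {..<n}" for k
      using slope_sw_poly_strict_mono[of k n] slope_sw_poly_nonneg[of k] sw_sqnorm_pos[of k] that
      by simp
  qed (use assms in auto)
  finally show ?thesis .
qed

lemma poly_sobolev_poly_0:
  "poly (sobolev_poly q \<alpha> n N) 0 = 1 - N * critical_mass_inverse q \<alpha> n"
  by (simp add: sobolev_poly_def critical_mass_inverse_def algebra_simps)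

text \<open>Termwise comparison of \<open>s k\<close> with \<open>s n\<close>: the quotient of the kernel by \<open>s n\<close> at a negative point
stays below its value at 0.\<close>

lemma poly_slope_kernel_less:
  assumes "2 \<le> n" "x < 0"
  shows "poly (K n) x < poly (K n) 0 * poly (s n) x"
  unfolding slope_kernel_eq_sum sum_distrib_right
proof (rule sum_strict_mono_ex1)
  have w: "0 \<le> D (s k) / sw_sqnorm q k" for k
    using slope_sw_poly_nonneg[of k] sw_sqnorm_pos[of k] by simp
  show "\<forall>k\<in>{..<n}. D (s k) / sw_sqnorm q k * poly (s k) x
      \<le> D (s k) / sw_sqnorm q k * poly (s k) 0 * poly (s n) x"
  proof
    fix k assume "k \<in> {..<n}"
    then have "poly (s k) x \<le> poly (s n) x"
      using poly_sw_poly_strict_mono[OF q0 q1 assms(2), of k n] by simp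
    then show "D (s k) / sw_sqnorm q k * poly (s k) x
      \<le> D (s k) / sw_sqnorm q k * poly (s k) 0 * poly (s n) x"
      using mult_left_mono[OF _ w] by simp
  qed
  have "0 < D (s 1) / sw_sqnorm q 1"
    using slope_sw_poly_strict_mono[of 0 1] sw_sqnorm_pos[of 1] by simp
  then have "D (s 1) / sw_sqnorm q 1 * poly (s 1) x < D (s 1) / sw_sqnorm q 1 * poly (s n) x"
    using poly_sw_poly_strict_mono[OF q0 q1 assms(2), of 1 n] assms by (intro mult_strict_left_mono) auto
  then show "\<exists>k\<in>{..<n}. D (s k) / sw_sqnorm q k * poly (s k) x
      < D (s k) / sw_sqnorm q k * poly (s k) 0 * poly (s n) x"
    using assms by (intro bexI[of _ 1]) auto
qed simp

text \<open>The Sobolev polynomial is its value at 0 times \<open>s n\<close>, plus a remainder that is positive on the negative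
axis for \<open>N > 0\<close>. The value at 0 is nonnegative as long as \<open>N\<close> does not pass the critical mass.\<close>

lemma poly_sobolev_poly_pos:
  assumes "2 \<le> n" "x < 0" "0 \<le> N" "N * critical_mass_inverse q \<alpha> n \<le> 1"
  shows "0 < poly (sobolev_poly q \<alpha> n N) x"
proof -
  have sn: "0 < poly (s n) x"
    using poly_sw_poly_ge_1[OF q0 q1 assms(2), of n] by simp
  have en: "0 < D (s n)"
    using slope_sw_poly_strict_mono[of 0 n] assms by simp
  have eq: "poly (sobolev_poly q \<alpha> n N) x
      = (1 - N * critical_mass_inverse q \<alpha> n) * poly (s n) x
        + N * (D (s n) * (poly (K n) 0 * poly (s n) x - poly (K n) x))"
    by (simp add: sobolev_poly_def critical_mass_inverse_def algebra_simps)
  have gap: "0 < D (s n) * (poly (K n) 0 * poly (s n) x - poly (K n) x)"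
    using en poly_slope_kernel_less[OF assms(1,2)] by simp
  show ?thesis
  proof (cases "N = 0")
    case True
    then show ?thesis using sn eq by simp
  next
    case False
    then have "0 < N * (D (s n) * (poly (K n) 0 * poly (s n) x - poly (K n) x))"
      using gap assms by simp
    moreover have "0 \<le> (1 - N * critical_mass_inverse q \<alpha> n) * poly (s n) x"
      using sn assms by simp
    ultimately show ?thesis unfolding eq by linarith
  qed
qed

text \<open>Constants have slope 0, so orthogonality to the constant 1 means that the plain moment functional
annihilates the Sobolev polynomial. Without a zero in \<open>(0, \<infinity>)\<close> it would have a fixed sign there and a
nonzero moment.\<close>

lemma sobolev_poly_has_positive_zero:
  assumes "0 < n" "0 \<le> N"
  shows "\<exists>x>0. poly (sobolev_poly q \<alpha> n N) x = 0"
proof (rule ccontr)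
  define Q where "Q = sobolev_poly q \<alpha> n N"
  assume "\<not> ?thesis"
  then have nz: "poly Q x \<noteq> 0" if "0 < x" for x
    using that by (auto simp: Q_def)
  have same: "0 < poly Q x * poly Q 1" if x: "0 < x" for x
  proof (rule ccontr)
    assume "\<not> 0 < poly Q x * poly Q 1"
    then have neg: "poly Q x * poly Q 1 < 0"
      using nz[OF x] nz[of 1] by (simp add: less_le not_less)
    then have "x \<noteq> 1" by (auto simp: mult_less_0_iff)
    then consider "x < 1" | "1 < x" by linarith
    then show False
      using poly_IVT[of x 1 Q] poly_IVT[of 1 x Q] neg nz x by cases (force simp: mult.commute)+
  qed
  have "0 < sw_moment q (smult (poly Q 1) Q)"
  proof (rule sw_moment_pos[OF q0 q1])
    show "smult (poly Q 1) Q \<noteq> 0" using nz[of 1] by auto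
    show "0 \<le> poly (smult (poly Q 1) Q) x" if "0 < x" for x
      using same[OF that] by (simp add: mult.commute)
  qed
  moreover have "sw_moment q (Q * 1) = 0"
    using sobolev_poly_orthogonal[of 1 n N] assms slope_const[of 1]
    by (simp add: Q_def sobolev_ip_poly del: poly_1)
  ultimately show False
    by (simp add: moment_smult)
qed

text \<open>Beyond the critical mass the value at 0 is negative, whereas the normalised polynomial tends to
\<open>+\<infinity>\<close> at \<open>-\<infinity>\<close>, because \<open>(-1) ^ n\<close> times its leading coefficient is positive.\<close>

lemma sobolev_poly_has_negative_zero:
  assumes "0 < n" "0 \<le> N" "1 < N * critical_mass_inverse q \<alpha> n"
  shows "\<exists>x<0. poly (sobolev_poly q \<alpha> n N) x = 0"
proof -
  define Q where "Q = sobolev_poly q \<alpha> n N"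
  \<comment> \<open>The reflection turns the behaviour at \<open>-\<infinity>\<close> into the behaviour at \<open>+\<infinity>\<close>.\<close>
  define R where "R = Q \<circ>\<^sub>p [:0, -1:]"
  have "lead_coeff R = (-1) ^ n * lead_coeff Q"
    using degree_sobolev_poly(1)[OF assms(1,2)] by (simp add: R_def Q_def lead_coeff_comp mult.commute)
  then have "0 < lead_coeff R"
    using degree_sobolev_poly(2)[OF assms(1,2)] by (simp add: Q_def)
  then obtain b where b: "\<And>y. b \<le> y \<Longrightarrow> lead_coeff R \<le> poly R y"
    using poly_pinfty_gt_lc by blast
  define y where "y = max b 1"
  have "0 < poly Q (- y)"
    using b[of y] \<open>0 < lead_coeff R\<close> by (simp add: R_def y_def poly_pcompose)
  moreover have "poly Q 0 < 0"
    using assms by (simp add: Q_def poly_sobolev_poly_0)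
  moreover have "- y < 0" by (simp add: y_def)
  ultimately show ?thesis
    using poly_IVT_neg[of "- y" 0 Q] by (auto simp: Q_def)
qed

end

theorem corollary3:
  fixes q \<alpha> N0 :: real and n :: nat
  assumes "0 < q" and "q < 1" and "n \<ge> 2" and "\<alpha> < 0"
    and N0: "N0 = inverse (qderiv q (stieltjes_wigert q n) \<alpha> / stieltjes_wigert q n 0
                             * sw_kernel q n 0 1 0 \<alpha>
                           - sw_kernel q n 1 1 \<alpha> \<alpha>)"
  shows "N0 > 0 \<and>
         (\<forall>N\<ge>0. (N < N0 \<longrightarrow> sw_sobolev_min_zero q \<alpha> N n > 0) \<and>
                (N = N0 \<longrightarrow> sw_sobolev_min_zero q \<alpha> N n = 0) \<and>
                (N > N0 \<longrightarrow> sw_sobolev_min_zero q \<alpha> N n < 0))"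
proof (intro conjI allI impI)
  note pre = assms(1,2,4)
  define c where "c = critical_mass_inverse q \<alpha> n"
  have c: "0 < c" using critical_mass_inverse_pos[OF pre assms(3)] by (simp add: c_def)
  have N0c: "N0 = inverse c"
    unfolding N0 c_def critical_mass_inverse_eq[OF pre] ..
  then show "N0 > 0" using c by simp
  fix N :: real assume N: "0 \<le> N"
  have n: "0 < n" using assms by simp
  define Q where "Q = sobolev_poly q \<alpha> n N"
  define Z where "Z = {x. poly Q x = 0}"
  have min: "sw_sobolev_min_zero q \<alpha> N n = Min Z"
    using sw_sobolev_min_zero_eq[OF pre n N] by (simp add: Z_def Q_def)
  have "Q \<noteq> 0" using degree_sobolev_poly(1)[OF pre n N] n by (auto simp: Q_def)
  then have fin: "finite Z" by (simp add: Z_def poly_roots_finite)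
  obtain z where z: "z \<in> Z" using sobolev_poly_has_positive_zero[OF pre n N] by (auto simp: Z_def Q_def)
  have Q0: "poly Q 0 = 1 - N * c"
    by (simp add: Q_def c_def poly_sobolev_poly_0[OF pre])
  have nonneg: "0 \<le> x" if "N \<le> N0" "x \<in> Z" for x
  proof (rule ccontr)
    assume "\<not> 0 \<le> x"
    moreover have "N * c \<le> 1" using that(1) c by (simp add: N0c field_simps)
    ultimately have "0 < poly Q x"
      using poly_sobolev_poly_pos[OF pre assms(3) _ N] by (simp add: Q_def c_def)
    then show False using that by (simp add: Z_def)
  qed
  show "sw_sobolev_min_zero q \<alpha> N n > 0" if "N < N0"
  proof -
    have "Min Z \<in> Z" using fin z by (intro Min_in) auto
    moreover have "0 \<notin> Z" using that c by (simp add: Z_def Q0 N0c field_simps)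
    ultimately show ?thesis
      unfolding min using nonneg[of "Min Z"] that by (cases "Min Z = 0") auto
  qed
  show "sw_sobolev_min_zero q \<alpha> N n = 0" if "N = N0"
    unfolding min using fin nonneg that c by (intro Min_eqI) (auto simp: Z_def Q0 N0c)
  show "sw_sobolev_min_zero q \<alpha> N n < 0" if "N > N0"
  proof -
    have "1 < N * c" using that c by (simp add: N0c field_simps)
    then obtain x where "x < 0" "x \<in> Z"
      using sobolev_poly_has_negative_zero[OF pre n N] by (auto simp: Z_def Q_def c_def)
    then show ?thesis
      unfolding min using Min_le[OF fin, of x] by simp
  qed
qed

end
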